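(* Let $A$ be a real $n\times n$ matrix which is involutory, i.e. $A^2=I_n$, and suppose $\det A>0$. Then $A$ has a real root, i.e. there exists a real $n\times n$ matrix $R$ such that $R^2=A$.
   Context: A square matrix $A$ is called involutory if $A^2=I$. A matrix $R$ is called a root of $A$ if $A=R^2$; a real root is a root with real entries. *)

theory Defs
  imports "HOL-Analysis.Analysis"
begin

definition involutory :: "'a::semiring_1 ^ 'n ^ 'n \<Rightarrow> bool"
  where "involutory A \<longleftrightarrow> A ** A = mat 1"

text \<open>A root has its entries in the same semiring as the matrix, so over \<^typ>\<open>real\<close> this
  is the notion of a real root.\<close>

definition matrix_root :: "'a::semiring_1 ^ 'n ^ 'n \<Rightarrow> 'a ^ 'n ^ 'n \<Rightarrow> bool"
  where "matrix_root R A \<longleftrightarrow> A = R ** R"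

end

theory Submission
  imports Defs
begin

text \<open>The eigenspaces of \<open>A\<close> for \<open>1\<close> and \<open>- 1\<close> span the whole space, so there is a basis of
  eigenvectors. The determinant is \<open>- 1\<close> to the number of basis vectors with eigenvalue \<open>- 1\<close>;
  when it is positive these vectors can be paired off, and the map that fixes the other basis
  vectors and rotates each pair \<open>(b, b')\<close> by \<open>b \<mapsto> b' \<mapsto> - b\<close> squares to \<open>A\<close>.\<close>

lemma even_card_split_bij:
  assumes "finite S" "even (card S)"
  obtains T U g where "S = T \<union> U" "T \<inter> U = {}" "bij_betw g T U"
proof -
  obtain T where T: "T \<subseteq> S" "card T = card S div 2"
    by (meson div_le_dividend obtain_subset_with_card_n)
  have "card (S - T) = card S - card T"
    using T assms(1) by (meson card_Diff_subset finite_subset)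
  \<comment> \<open>Evenness makes \<open>card S div 2\<close> an exact half, so the complement has
    the same size as \<open>T\<close>.\<close>
  then have "card T = card (S - T)"
    using T(2) assms(2) by auto
  then obtain g where "bij_betw g T (S - T)"
    using T(1) assms(1) by (meson finite_Diff finite_same_card_bij finite_subset)
  then show thesis
    using T(1) by (intro that[of T "S - T" g]) auto
qed

lemma sqrt_linear_of_even_signature:
  fixes B :: "'a::euclidean_space set" and f :: "'a \<Rightarrow> 'a"
  assumes "independent B" and "span B = UNIV" and "linear f"
    and "S \<subseteq> B" and "even (card S)"
    and neg: "\<And>b. b \<in> S \<Longrightarrow> f b = - b"
    and pos: "\<And>b. b \<in> B - S \<Longrightarrow> f b = b"
  obtains r where "linear r" "r \<circ> r = f"
proof -
  have "finite S"
    using assms(1,4) by (meson finite_subset independent_bound)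
  then obtain T U g where S: "S = T \<union> U" and disj: "T \<inter> U = {}" and g: "bij_betw g T U"
    using assms(5) by (rule even_card_split_bij)
  let ?h = "inv_into T g"
  let ?r = "\<lambda>b. if b \<in> T then g b else if b \<in> U then - ?h b else b"
  \<comment> \<open>The pairs are \<open>(b, g b)\<close> with \<open>b\<close> in \<open>T\<close>;
    \<open>?h\<close> leads from the second member back to the first, and the minus sign on
    \<open>U\<close> makes each pair a quarter turn.\<close>
  obtain r where r: "linear r" "\<And>b. b \<in> B \<Longrightarrow> r b = ?r b"
    using linear_independent_extend[OF assms(1), of ?r] by blast
  have "(r \<circ> r) b = f b" if b: "b \<in> B" for b
  proof -
    consider "b \<in> T" | "b \<in> U" | "b \<notin> S"
      using S by blast
    then show ?thesis
    proof cases
      case 1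
      then have gb: "g b \<in> U"
        using g by (rule bij_betw_apply[rotated])
      then have "g b \<in> B" "g b \<notin> T"
        using S disj assms(4) by auto
      then have "r (g b) = - b"
        using gb r(2)[of "g b"] bij_betw_inv_into_left[OF g 1] by simp
      then show ?thesis
        using 1 S r(2)[OF b] neg[of b] by simp
    next
      case 2
      then have hb: "?h b \<in> T"
        using bij_betw_inv_into[OF g] by (rule bij_betw_apply[rotated])
      then have "r (?h b) = b"
        using S assms(4) r(2)[of "?h b"] bij_betw_inv_into_right[OF g 2] by auto
      moreover have "b \<notin> T"
        using 2 disj by blast
      \<comment> \<open>Here \<open>r b = - ?h b\<close>, and \<open>r\<close> is prescribed only on
        \<open>B\<close>; linearity gives \<open>r (- ?h b) = - r (?h b) = - b\<close>.\<close>
      ultimately show ?thesis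
        using 2 S r(2)[OF b] neg[of b] linear_neg[OF r(1)] by simp
    next
      case 3
      then show ?thesis
        using S b r(2)[OF b] pos[of b] by auto
    qed
  qed
  then have "r \<circ> r = f"
    using linear_eq_on_span[OF linear_compose[OF r(1) r(1)] assms(3), of B] assms(2) by auto
  with r(1) show thesis
    by (rule that)
qed

text \<open>Taking the basis vectors as columns of \<open>P\<close> and the eigenvalues as diagonal
  of \<open>D\<close> gives \<open>A ** P = P ** D\<close>. As \<open>P\<close> is invertible,
  \<open>A\<close> and \<open>D\<close> have the same determinant.\<close>

lemma det_eq_prod_eigenvalues:
  fixes A :: "real^'n^'n" and B :: "(real^'n) set"
  assumes "independent B" and "span B = UNIV"
    and eig: "\<And>b. b \<in> B \<Longrightarrow> A *v b = c b *\<^sub>R b"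
  shows "det A = prod c B"
proof -
  have "card B = CARD('n)"
    using dim_eq_card_independent[OF assms(1)] assms(2) dim_span[of B] by simp
  moreover have "finite B"
    using assms(1) by (rule independent_imp_finite)
  \<comment> \<open>Numbering \<open>B\<close> by the index type \<open>'n\<close> makes its vectors
    the columns of a square matrix.\<close>
  ultimately obtain e where e: "bij_betw e (UNIV :: 'n set) B"
    using finite_same_card_bij[of "UNIV :: 'n set" B] by auto
  define P where "P = (\<chi> i j. e j $ i)"
  define D where "D = (\<chi> i j. if i = j then c (e j) else 0)"
  have col: "column j P = e j" for j
    by (simp add: P_def column_def vec_eq_iff)
  have "columns P = B"
    using e by (auto simp: columns_def col bij_betw_def)
  then have "det P \<noteq> 0"
    using matrix_right_invertible_span_columns[of P] assms(2)
    by (simp add: invertible_right_inverse span_vec_eq flip: invertible_det_nz)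
  have "(A ** P) $ i $ j = (P ** D) $ i $ j" for i j
  proof -
    have "(A ** P) $ i $ j = (A *v e j) $ i"
      by (simp add: P_def matrix_matrix_mult_def matrix_vector_mult_def)
    also have "\<dots> = c (e j) * e j $ i"
      using e eig by (simp add: bij_betw_apply)
    also have "\<dots> = (P ** D) $ i $ j"
      by (simp add: P_def D_def matrix_matrix_mult_def if_distrib cong: if_cong)
    finally show ?thesis .
  qed
  then have "A ** P = P ** D"
    by (simp add: vec_eq_iff)
  then have "det A * det P = det P * det D"
    by (metis det_mul)
  with \<open>det P \<noteq> 0\<close> have "det A = det D"
    by simp
  also have "\<dots> = (\<Prod>j\<in>UNIV. c (e j))"
    by (subst det_diagonal) (simp_all add: D_def)
  also have "\<dots> = prod c B"
    using e by (rule prod.reindex_bij_betw)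
  finally show ?thesis .
qed

text \<open>Every \<open>x\<close> is half the sum of \<open>x + A *v x\<close> and
  \<open>x - A *v x\<close>, which \<open>A\<close> fixes and negates respectively because its
  square is the identity.\<close>

lemma involutory_eigenbasis:
  fixes A :: "real^'n^'n"
  assumes "involutory A"
  obtains B where "independent B" "span B = UNIV" "\<And>b. b \<in> B \<Longrightarrow> A *v b = b \<or> A *v b = - b"
proof -
  let ?E = "{v. A *v v = v \<or> A *v v = - v}"
  \<comment> \<open>\<open>?E\<close> is the union of the two eigenspaces, in general not a
    subspace; a maximal independent subset still spans all of it.\<close>
  obtain B where B: "B \<subseteq> ?E" "independent B" "?E \<subseteq> span B"
    by (rule basis_exists[of ?E])
  have "x \<in> span B" for x
  proof -
    have AA: "A *v (A *v x) = x"
      using assms by (simp add: involutory_def matrix_vector_mul_assoc)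
    then have "x + A *v x \<in> ?E" "x - A *v x \<in> ?E"
      by (simp_all add: matrix_vector_right_distrib matrix_vector_mult_diff_distrib)
    then have "(1/2) *\<^sub>R ((x + A *v x) + (x - A *v x)) \<in> span B"
      using B(3) by (blast intro: span_mul span_add)
    then show ?thesis
      by (simp flip: scaleR_2)
  qed
  with B show thesis
    by (intro that[of B]) auto
qed

theorem theorem2p5:
  fixes A :: "real ^ 'n ^ 'n"
  assumes "involutory A"
    and "det A > 0"
  shows "\<exists>R :: real ^ 'n ^ 'n. matrix_root R A"
proof -
  obtain B where B: "independent B" "span B = UNIV" "\<And>b. b \<in> B \<Longrightarrow> A *v b = b \<or> A *v b = - b"
    using assms(1) by (rule involutory_eigenbasis) blast
  define S where "S = {b \<in> B. A *v b = - b}"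
  have "finite B"
    using B(1) by (rule independent_imp_finite)
  have "det A = (\<Prod>b\<in>B. if A *v b = - b then - 1 else 1)"
    using B by (intro det_eq_prod_eigenvalues) auto
  also have "\<dots> = (- 1) ^ card S"
    using \<open>finite B\<close> by (simp add: prod.If_cases S_def Int_def)
  \<comment> \<open>An odd number of factors \<open>- 1\<close> would make the determinant
    \<open>- 1\<close>.\<close>
  finally have "even (card S)"
    using assms(2) by (cases "even (card S)") auto
  moreover have "S \<subseteq> B" "\<And>b. b \<in> S \<Longrightarrow> A *v b = - b" "\<And>b. b \<in> B - S \<Longrightarrow> A *v b = b"
    using B(3) by (auto simp: S_def)
  ultimately obtain r where r: "linear r" "r \<circ> r = (\<lambda>x. A *v x)"
    using sqrt_linear_of_even_signature[OF B(1,2) matrix_vector_mul_linear[of A]] by metis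
  \<comment> \<open>Composition of linear maps becomes multiplication of matrices, so
    \<open>matrix r\<close> is the root.\<close>
  have "A = matrix (r \<circ> r)"
    by (simp add: r(2))
  also have "\<dots> = matrix r ** matrix r"
    using r(1) r(1) by (rule matrix_compose)
  finally show ?thesis
    unfolding matrix_root_def by blast
qed

end
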